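(* Let $m\ge 1$ and $N\ge 2$ be integers, let $A\in\mathbb{R}^{m\times N}$ be a random matrix whose entries are independent Rademacher random variables, and let $\kappa=\sqrt{8\ln(N)}$. Then, with failure probability at most $1/3$, both of the following conditions are fulfilled: (a) $\displaystyle \Big|\sum_{j=1}^m A_{j,k}A_{j,k'}\Big|\le \kappa\sqrt{m}$ for all distinct $k,k'\in\{1,\dots,N\}$; (b) $\displaystyle \Big|\sum_{j=1}^m A_{j,k}A_{j,k'}A_{j,\ell}A_{j,\ell'}\Big|\le \kappa\sqrt{m}$ for all (pairwise) distinct $k,k',\ell,\ell'\in\{1,\dots,N\}$.
   Context: A Rademacher random variable takes the values $+1$ and $-1$ with probability $1/2$ each. *)

theory Defs
  imports "HOL-Probability.Probability"
begin

definition rademacher :: "'a measure \<Rightarrow> ('a \<Rightarrow> real) \<Rightarrow> bool" where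
  "rademacher M X \<longleftrightarrow>
     X \<in> borel_measurable M \<and>
     measure M {\<omega> \<in> space M. X \<omega> = 1} = 1 / 2 \<and>
     measure M {\<omega> \<in> space M. X \<omega> = - 1} = 1 / 2"

text \<open>A random \<open>m \<times> N\<close> matrix is given by its entries: \<open>A j k\<close> is a random variable on \<open>M\<close>
  for \<open>j \<in> {1..m}\<close> and \<open>k \<in> {1..N}\<close>, and its values at other indices are irrelevant.\<close>

definition rademacher_matrix ::
    "'a measure \<Rightarrow> nat \<Rightarrow> nat \<Rightarrow> (nat \<Rightarrow> nat \<Rightarrow> 'a \<Rightarrow> real) \<Rightarrow> bool" where
  "rademacher_matrix M m N A \<longleftrightarrow>
     (\<forall>j\<in>{1..m}. \<forall>k\<in>{1..N}. rademacher M (A j k)) \<and>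
     prob_space.indep_vars M (\<lambda>_. borel) (\<lambda>(j, k). A j k) ({1..m} \<times> {1..N})"

end

(* For a fixed set T of 2 or 4 columns, the row products over T are independent, centred and
   almost surely in {-1, 1}, so Hoeffding's inequality bounds the probability of a violation by
   2 exp(-kappa^2 / 2) = 2 / N^4. The sums do not depend on the order of the columns, so it
   suffices to take the union bound over unordered sets T, which gives at most
   (N^2 / 2 + N^4 / 24) * 2 / N^4 = 1 / N^2 + 1 / 12 <= 1 / 3, with N >= 2 in the last step. *)
theory Submission
  imports Defs
begin

context prob_space
begin

text \<open>The events \<open>X = 1\<close> and \<open>X = -1\<close> are disjoint and their
  probabilities add up to 1. \<open>rademacher\<close> fixes only these probabilities, so
  two-valuedness holds almost surely and not pointwise.\<close>

lemma rademacher_AE: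
  assumes "rademacher M X"
  shows "AE \<omega> in M. X \<omega> = 1 \<or> X \<omega> = -1"
proof -
  have [measurable]: "X \<in> borel_measurable M"
    and half: "prob {\<omega> \<in> space M. X \<omega> = 1} = 1 / 2" "prob {\<omega> \<in> space M. X \<omega> = -1} = 1 / 2"
    using assms by (auto simp: rademacher_def)
  have "prob ({\<omega> \<in> space M. X \<omega> = 1} \<union> {\<omega> \<in> space M. X \<omega> = -1}) = 1"
    by (subst finite_measure_Union) (use half in auto)
  then have "AE \<omega> in M. \<omega> \<in> {\<omega> \<in> space M. X \<omega> = 1} \<union> {\<omega> \<in> space M. X \<omega> = -1}"
    by (subst (asm) prob_eq_1) auto
  then show ?thesis by eventually_elim auto
qed

lemma rademacher_integrable:
  assumes "rademacher M X"
  shows "integrable M X"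
proof (rule integrable_const_bound[where B = 1])
  show "AE \<omega> in M. norm (X \<omega>) \<le> 1"
    using rademacher_AE[OF assms] by eventually_elim auto
qed (use assms in \<open>simp add: rademacher_def\<close>)

lemma rademacher_expectation:
  assumes "rademacher M X"
  shows "expectation X = 0"
proof -
  have [measurable]: "X \<in> borel_measurable M"
    and half: "prob {\<omega> \<in> space M. X \<omega> = 1} = 1 / 2" "prob {\<omega> \<in> space M. X \<omega> = -1} = 1 / 2"
    using assms by (auto simp: rademacher_def)
  \<comment> \<open>Almost surely \<open>X\<close> is the difference of the indicators of its two
    level sets, whose probabilities cancel.\<close>
  have "expectation X = expectation (\<lambda>\<omega>. indicator {\<omega> \<in> space M. X \<omega> = 1} \<omega>
          - indicator {\<omega> \<in> space M. X \<omega> = -1} \<omega>)"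
  proof (rule integral_cong_AE)
    show "AE \<omega> in M. X \<omega> = indicator {\<omega> \<in> space M. X \<omega> = 1} \<omega>
          - indicator {\<omega> \<in> space M. X \<omega> = -1} \<omega>"
      using rademacher_AE[OF assms] AE_space by eventually_elim (auto simp: indicator_def)
  qed auto
  also have "\<dots> = 0"
    by (subst Bochner_Integration.integral_diff) (use half in \<open>auto simp: less_top[symmetric]\<close>)
  finally show ?thesis .
qed

lemma rademacher_prod_bounds:
  assumes "finite K" "\<And>i. i \<in> K \<Longrightarrow> rademacher M (X i)"
  shows "AE \<omega> in M. (\<Prod>i\<in>K. X i \<omega>) \<in> {-1..1}"
proof -
  have "AE \<omega> in M. \<forall>i\<in>K. X i \<omega> = 1 \<or> X i \<omega> = -1"
    using assms by (intro AE_finite_allI rademacher_AE)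
  then show ?thesis
  proof eventually_elim
    case (elim \<omega>)
    have "\<bar>\<Prod>i\<in>K. X i \<omega>\<bar> = (\<Prod>i\<in>K. \<bar>X i \<omega>\<bar>)"
      by (rule abs_prod)
    also have "\<dots> = 1"
      using elim by (intro prod.neutral) auto
    finally show ?case by auto
  qed
qed

text \<open>Independence factorises the expectation into zeros. The index set must be nonempty,
  since the empty product has expectation 1.\<close>

lemma rademacher_prod_expectation:
  assumes "finite K" "K \<noteq> {}" "\<And>i. i \<in> K \<Longrightarrow> rademacher M (X i)"
    and "indep_vars (\<lambda>_. borel) X K"
  shows "expectation (\<lambda>\<omega>. \<Prod>i\<in>K. X i \<omega>) = 0"
proof -
  have "expectation (\<lambda>\<omega>. \<Prod>i\<in>K. X i \<omega>) = (\<Prod>i\<in>K. expectation (X i))"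
    using assms by (intro indep_vars_lebesgue_integral rademacher_integrable)
  also have "\<dots> = 0"
    using assms by (auto simp: rademacher_expectation)
  finally show ?thesis .
qed

text \<open>Products over disjoint blocks of an independent family are again independent, and here
  also centred and bounded by 1, so Hoeffding's inequality applies to their sum. Each summand ranges
  over an interval of length 2, so the exponent is
  \<open>2 * \<epsilon>\<^sup>2 / (4 * card J)\<close>.\<close>

lemma rademacher_chaos_tail:
  assumes ind: "indep_vars (\<lambda>_. borel) X I"
    and rad: "\<And>i. i \<in> I \<Longrightarrow> rademacher M (X i)"
    and J: "finite J" "J \<noteq> {}"
    and K: "\<And>j. j \<in> J \<Longrightarrow> K j \<subseteq> I \<and> finite (K j) \<and> K j \<noteq> {}" "disjoint_family_on K J"
    and "\<epsilon> \<ge> 0"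
  shows "prob {\<omega> \<in> space M. \<bar>\<Sum>j\<in>J. \<Prod>i\<in>K j. X i \<omega>\<bar> \<ge> \<epsilon>} \<le> 2 * exp (- \<epsilon>\<^sup>2 / (2 * card J))"
proof -
  define Y where "Y = (\<lambda>j \<omega>. \<Prod>i\<in>K j. X i \<omega>)"
  \<comment> \<open>Each block product is written as a measurable function of the family restricted
    to its block, the form in which grouping into disjoint blocks preserves independence.\<close>
  have "indep_vars (\<lambda>_. borel)
      (\<lambda>j \<omega>. (\<lambda>f. \<Prod>i\<in>K j. f i) (restrict (\<lambda>i. X i \<omega>) (K j))) J"
    by (rule indep_vars_compose2[OF indep_vars_restrict[OF ind _ K(2)]])
      (use K(1) in \<open>auto intro!: borel_measurable_prod\<close>)
  then have Y_ind: "indep_vars (\<lambda>_. borel) Y J"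
    by (simp add: Y_def)
  have Y_exp: "expectation (Y j) = 0" if "j \<in> J" for j
    unfolding Y_def using K(1)[OF that] rad
    by (intro rademacher_prod_expectation indep_vars_subset[OF ind]) auto
  \<comment> \<open>The final \<open>0\<close> is the sum of the expectations, by
    \<open>Y_exp\<close>.\<close>
  interpret Hoeffding_ineq M J Y "\<lambda>_. -1" "\<lambda>_. 1" 0
  proof unfold_locales
    show "AE \<omega> in M. Y j \<omega> \<in> {-1..1}" if "j \<in> J" for j
      unfolding Y_def using K(1)[OF that] rad by (intro rademacher_prod_bounds) auto
  qed (use J Y_ind Y_exp in auto)
  have "prob {\<omega> \<in> space M. \<bar>(\<Sum>j\<in>J. Y j \<omega>) - 0\<bar> \<ge> \<epsilon>}
      \<le> 2 * exp (- 2 * \<epsilon>\<^sup>2 / (\<Sum>j\<in>J. (1 - (-1))\<^sup>2))"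
    using J \<open>\<epsilon> \<ge> 0\<close> by (intro Hoeffding_ineq_abs_ge) (auto simp: card_gt_0_iff)
  then show ?thesis
    by (simp add: Y_def divide_simps)
qed

text \<open>The blocks are the sets \<open>{j} \<times> T\<close>, one per row, which are disjoint
  for different rows. The bound does not depend on the size of \<open>T\<close>, so it serves pairs
  and quadruples alike.\<close>

lemma rademacher_matrix_columns_tail:
  assumes "rademacher_matrix M m N A" "m \<ge> 1" "N \<ge> 1" "T \<subseteq> {1..N}" "T \<noteq> {}"
  shows "prob {\<omega> \<in> space M. \<bar>\<Sum>j=1..m. \<Prod>k\<in>T. A j k \<omega>\<bar> \<ge> sqrt (8 * ln N) * sqrt m} \<le> 2 / real N ^ 4"
proof -
  have T: "finite T"
    using assms(4) by (rule finite_subset) simp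
  have prod_row: "(\<Prod>p\<in>{j}\<times>T. (case p of (j, k) \<Rightarrow> A j k) \<omega>) = (\<Prod>k\<in>T. A j k \<omega>)" for j \<omega>
  proof -
    have "{j} \<times> T = Pair j ` T" by auto
    then show ?thesis by (simp add: prod.reindex inj_on_def)
  qed
  have "prob {\<omega> \<in> space M. \<bar>\<Sum>j=1..m. \<Prod>p\<in>{j}\<times>T. (case p of (j, k) \<Rightarrow> A j k) \<omega>\<bar>
          \<ge> sqrt (8 * ln N) * sqrt m} \<le> 2 * exp (- (sqrt (8 * ln N) * sqrt m)\<^sup>2 / (2 * card {1..m}))"
    using assms T
    by (intro rademacher_chaos_tail[where I = "{1..m} \<times> {1..N}"])
      (auto simp: rademacher_matrix_def disjoint_family_on_def)
  \<comment> \<open>The number of rows cancels, and \<open>ln N\<close> is nonnegative, so squaring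
    undoes the root.\<close>
  also have "- (sqrt (8 * ln N) * sqrt m)\<^sup>2 / (2 * card {1..m}) = - (4 * ln N)"
    using assms by (simp add: power_mult_distrib field_simps)
  also have "2 * exp (- (4 * ln N)) = 2 / real N ^ 4"
    using assms by (simp add: exp_minus exp_of_nat_mult[of 4, simplified] divide_inverse)
  finally show ?thesis by (simp only: prod_row)
qed

end

text \<open>\<open>(n choose k) * fact k\<close> is a falling factorial of \<open>k\<close> factors,
  each at most \<open>n\<close>.\<close>

lemma binomial_le_pow_div_fact: "real (n choose k) \<le> real n ^ k / fact k"
proof -
  have "real ((n choose k) * fact k) \<le> real (n ^ k)"
    by (intro of_nat_mono binomial_fact_pow)
  then show ?thesis by (simp add: field_simps)
qed

theorem mainTheorem2:
  fixes M :: "'a measure" and m N :: nat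
    and A :: "nat \<Rightarrow> nat \<Rightarrow> 'a \<Rightarrow> real" and \<kappa> :: real
  assumes "prob_space M"
    and "m \<ge> 1" and "N \<ge> 2"
    and "rademacher_matrix M m N A"
    and "\<kappa> = sqrt (8 * ln (real N))"
  shows "measure M {\<omega> \<in> space M. \<not> (
      (\<forall>k\<in>{1..N}. \<forall>k'\<in>{1..N}. k \<noteq> k' \<longrightarrow>
         \<bar>\<Sum>j=1..m. A j k \<omega> * A j k' \<omega>\<bar> \<le> \<kappa> * sqrt (real m)) \<and>
      (\<forall>k\<in>{1..N}. \<forall>k'\<in>{1..N}. \<forall>l\<in>{1..N}. \<forall>l'\<in>{1..N}. distinct [k, k', l, l'] \<longrightarrow>
         \<bar>\<Sum>j=1..m. A j k \<omega> * A j k' \<omega> * A j l \<omega> * A j l' \<omega>\<bar> \<le> \<kappa> * sqrt (real m)))}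
    \<le> 1 / 3"
proof -
  interpret prob_space M by fact
  define F where "F = (\<lambda>T. {\<omega> \<in> space M. \<bar>\<Sum>j=1..m. \<Prod>k\<in>T. A j k \<omega>\<bar> \<ge> \<kappa> * sqrt m})"
  \<comment> \<open>Sets rather than tuples: a union bound over ordered quadruples would cost
    \<open>N ^ 4 * (2 / N ^ 4) = 2\<close>, which says nothing. The factor \<open>1 / fact d\<close>
    gained here is essential.\<close>
  define C where "C = (\<lambda>d. {T. T \<subseteq> {1..N} \<and> card T = d})"
  have fin: "finite (C d)" for d
    unfolding C_def by simp
  have rv [measurable]: "A j k \<in> borel_measurable M" if "j \<in> {1..m}" "k \<in> {1..N}" for j k
    using assms(4) that by (auto simp: rademacher_matrix_def rademacher_def)
  have F_sets: "F T \<in> events" if "T \<in> C d" for T d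
  proof -
    have [measurable]: "A j k \<in> borel_measurable M" if "j \<in> {1..m}" "k \<in> T" for j k
      using \<open>T \<in> C d\<close> that by (intro rv) (auto simp: C_def)
    show ?thesis unfolding F_def by measurable
  qed
  have prob_F: "prob (F T) \<le> 2 / real N ^ 4" if "T \<in> C d" "d > 0" for T d
    unfolding F_def assms(5) using that assms
    by (intro rademacher_matrix_columns_tail) (auto simp: C_def)
  have prob_C: "prob (\<Union>T\<in>C d. F T) \<le> real N ^ d / fact d * (2 / real N ^ 4)" if "d > 0" for d
  proof -
    have "prob (\<Union>T\<in>C d. F T) \<le> (\<Sum>T\<in>C d. prob (F T))"
      using fin F_sets by (intro finite_measure_subadditive_finite) auto
    also have "\<dots> \<le> (\<Sum>T\<in>C d. 2 / real N ^ 4)"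
      using that by (intro sum_mono prob_F)
    also have "\<dots> = real (N choose d) * (2 / real N ^ 4)"
      using n_subsets[of "{1..N}" d] by (simp add: C_def)
    also have "\<dots> \<le> real N ^ d / fact d * (2 / real N ^ 4)"
      using binomial_le_pow_div_fact[of N d] by (intro mult_right_mono) simp_all
    finally show ?thesis .
  qed
  have "prob {\<omega> \<in> space M. \<not> (
      (\<forall>k\<in>{1..N}. \<forall>k'\<in>{1..N}. k \<noteq> k' \<longrightarrow>
         \<bar>\<Sum>j=1..m. A j k \<omega> * A j k' \<omega>\<bar> \<le> \<kappa> * sqrt (real m)) \<and>
      (\<forall>k\<in>{1..N}. \<forall>k'\<in>{1..N}. \<forall>l\<in>{1..N}. \<forall>l'\<in>{1..N}. distinct [k, k', l, l'] \<longrightarrow>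
         \<bar>\<Sum>j=1..m. A j k \<omega> * A j k' \<omega> * A j l \<omega> * A j l' \<omega>\<bar> \<le> \<kappa> * sqrt (real m)))}
    \<le> prob ((\<Union>T\<in>C 2. F T) \<union> (\<Union>T\<in>C 4. F T))" (is "prob {\<omega> \<in> space M. \<not> (?P \<omega> \<and> ?Q \<omega>)} \<le> _")
  proof (rule finite_measure_mono)
    show "(\<Union>T\<in>C 2. F T) \<union> (\<Union>T\<in>C 4. F T) \<in> events"
      using fin F_sets by (intro sets.Un sets.finite_UN) auto
    show "{\<omega> \<in> space M. \<not> (?P \<omega> \<and> ?Q \<omega>)} \<subseteq> (\<Union>T\<in>C 2. F T) \<union> (\<Union>T\<in>C 4. F T)"
    proof (intro subsetI)
      fix \<omega>
      assume "\<omega> \<in> {\<omega> \<in> space M. \<not> (?P \<omega> \<and> ?Q \<omega>)}"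
      then have \<omega>: "\<omega> \<in> space M" and "\<not> ?P \<omega> \<or> \<not> ?Q \<omega>"
        by blast+
      from this(2) show "\<omega> \<in> (\<Union>T\<in>C 2. F T) \<union> (\<Union>T\<in>C 4. F T)"
      proof
        assume "\<not> ?P \<omega>"
        then obtain k k' where "k \<in> {1..N}" "k' \<in> {1..N}" "k \<noteq> k'"
          "\<not> \<bar>\<Sum>j=1..m. A j k \<omega> * A j k' \<omega>\<bar> \<le> \<kappa> * sqrt (real m)"
          by blast
        \<comment> \<open>Since \<open>k\<close> and \<open>k'\<close> differ, the product over
          \<open>{k, k'}\<close> has exactly the two expected factors. A violation is a strict
          inequality, hence lies in the event \<open>F\<close>, defined with \<ge>.\<close>
        with \<omega> have "\<omega> \<in> F {k, k'}" "{k, k'} \<in> C 2"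
          by (auto simp: F_def C_def)
        then show ?thesis by blast
      next
        assume "\<not> ?Q \<omega>"
        then obtain k k' l l' where "k \<in> {1..N}" "k' \<in> {1..N}" "l \<in> {1..N}" "l' \<in> {1..N}"
          "distinct [k, k', l, l']"
          "\<not> \<bar>\<Sum>j=1..m. A j k \<omega> * A j k' \<omega> * A j l \<omega> * A j l' \<omega>\<bar> \<le> \<kappa> * sqrt (real m)"
          by blast
        with \<omega> have "\<omega> \<in> F {k, k', l, l'}" "{k, k', l, l'} \<in> C 4"
          by (auto simp: F_def C_def mult.assoc)
        then show ?thesis by blast
      qed
    qed
  qed
  also have "\<dots> \<le> prob (\<Union>T\<in>C 2. F T) + prob (\<Union>T\<in>C 4. F T)"
    using fin F_sets by (intro measure_Un_le sets.finite_UN) auto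
  also have "\<dots> \<le> real N ^ 2 / fact 2 * (2 / real N ^ 4) + real N ^ 4 / fact 4 * (2 / real N ^ 4)"
    by (intro add_mono prob_C) auto
  also have "\<dots> = 1 / real N ^ 2 + 1 / 12"
    using assms(3) by (simp add: fact_numeral field_simps power_eq_if)
  \<comment> \<open>The case \<open>N = 2\<close> is the worst, and there the bound is exactly 1/4 +
    1/12 = 1/3.\<close>
  also have "\<dots> \<le> 1 / 2 ^ 2 + 1 / 12"
    using assms(3) by (intro add_mono divide_left_mono power_mono) auto
  finally show ?thesis by simp
qed

end
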